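(* Let $R$ be a commutative ring with $1$ and $\preceq$ a binary relation on $R$. Then $(R,\preceq)$ is a quasi-ordered ring if and only if either $(R,\preceq)$ is an ordered ring, or else there is a valuation $v$ on $R$ such that for all $x,y\in R$: $x\preceq y\Leftrightarrow v(y)\le v(x)$. Moreover, the support of the quasi-order coincides with the support of the order, respectively with the support of the valuation.
   Context: For a reflexive and transitive binary relation $\preceq$ on a set, write $a\sim b$ for ($a\preceq b$ and $b\preceq a$), and $a\prec b$ for ($a\preceq b$ and not $b\preceq a$). Quasi-ordered ring: a pair $(R,\preceq)$ where $R$ is a commutative ring with $1$ and $\preceq$ is a binary, reflexive, transitive and total relation on $R$ such that for all $x,y,z\in R$: (QR1) $0\prec 1$; (QR2) $xy\preceq 0\Rightarrow x\preceq 0$ or $y\preceq 0$; (QR3) $x\preceq y$ and $0\preceq z\Rightarrow xz\preceq yz$; (QR4) $x\preceq y$ and $z\nsim y\Rightarrow x+z\preceq y+z$; (QR5) if $0\prec z$, then $xz\preceq yz\Rightarrow x\preceq y$. Its support is $E_0=\{x\in R: x\sim 0\}$. Ordered ring: a pair $(R,\le)$ where $\le$ is a binary, reflexive, transitive and total relation on $R$ (not necessarily antisymmetric) such that for all $x,y,z\in R$: (O1) $0<1$ (i.e. $0\le 1$ and not $1\le 0$); (O2) $xy\le 0\Rightarrow x\le 0$ or $y\le 0$; (O3) $x\le y$ and $0\le z\Rightarrow xz\le yz$; (O4) $x\le y\Rightarrow x+z\le y+z$. Its support is $\{x\in R: x\le 0 \text{ and } 0\le x\}$. Valuation: a map $v:R\to\Gamma\cup\{\infty\}$,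 where $\Gamma$ is a (totally) ordered abelian group, $\gamma<\infty$ and $\infty=\infty+\infty=\gamma+\infty=\infty+\gamma$ for all $\gamma\in\Gamma$, such that for all $x,y\in R$: $v(0)=\infty$, $v(1)=0$, $v(xy)=v(x)+v(y)$, $v(x+y)\ge\min\{v(x),v(y)\}$. It is always assumed that $\Gamma$ is the group generated by $\{v(x): v(x)\ne\infty\}$. The support of $v$ is $v^{-1}(\infty)$. *)

theory Defs
  imports "HOL-Algebra.Ring" "HOL-Algebra.Generated_Groups"
begin

definition order_equiv :: "('a \<Rightarrow> 'a \<Rightarrow> bool) \<Rightarrow> 'a \<Rightarrow> 'a \<Rightarrow> bool" where
  "order_equiv leq a b \<longleftrightarrow> leq a b \<and> leq b a"

definition order_strict :: "('a \<Rightarrow> 'a \<Rightarrow> bool) \<Rightarrow> 'a \<Rightarrow> 'a \<Rightarrow> bool" where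
  "order_strict leq a b \<longleftrightarrow> leq a b \<and> \<not> leq b a"

text \<open>A relation on \<open>R\<close> is a predicate of which only the values on \<open>carrier R\<close> matter.\<close>

locale quasi_ordered_ring = cring R
  for R :: "('a, 'm) ring_scheme" (structure) and leq :: "'a \<Rightarrow> 'a \<Rightarrow> bool" (infix \<open>\<preceq>\<close> 50) +
  assumes qo_refl: "reflp_on (carrier R) (\<preceq>)"
    and qo_trans: "transp_on (carrier R) (\<preceq>)"
    and qo_total: "totalp_on (carrier R) (\<preceq>)"
    and QR1: "order_strict (\<preceq>) \<zero> \<one>"
    and QR2: "\<lbrakk>x \<in> carrier R; y \<in> carrier R; x \<otimes> y \<preceq> \<zero>\<rbrakk> \<Longrightarrow> x \<preceq> \<zero> \<or> y \<preceq> \<zero>"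
    and QR3: "\<lbrakk>x \<in> carrier R; y \<in> carrier R; z \<in> carrier R; x \<preceq> y; \<zero> \<preceq> z\<rbrakk>
      \<Longrightarrow> x \<otimes> z \<preceq> y \<otimes> z"
    and QR4: "\<lbrakk>x \<in> carrier R; y \<in> carrier R; z \<in> carrier R; x \<preceq> y; \<not> order_equiv (\<preceq>) z y\<rbrakk>
      \<Longrightarrow> x \<oplus> z \<preceq> y \<oplus> z"
    and QR5: "\<lbrakk>x \<in> carrier R; y \<in> carrier R; z \<in> carrier R; order_strict (\<preceq>) \<zero> z;
      x \<otimes> z \<preceq> y \<otimes> z\<rbrakk> \<Longrightarrow> x \<preceq> y"

definition quasi_order_support ::
    "('a, 'm) ring_scheme \<Rightarrow> ('a \<Rightarrow> 'a \<Rightarrow> bool) \<Rightarrow> 'a set" where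
  "quasi_order_support R leq = {x \<in> carrier R. order_equiv leq x \<zero>\<^bsub>R\<^esub>}"

text \<open>Antisymmetry is deliberately not required: the support of the order need not be zero.\<close>

locale ord_ring = cring R
  for R :: "('a, 'm) ring_scheme" (structure) and leq :: "'a \<Rightarrow> 'a \<Rightarrow> bool" (infix \<open>\<preceq>\<close> 50) +
  assumes ord_refl: "reflp_on (carrier R) (\<preceq>)"
    and ord_trans: "transp_on (carrier R) (\<preceq>)"
    and ord_total: "totalp_on (carrier R) (\<preceq>)"
    and O1: "order_strict (\<preceq>) \<zero> \<one>"
    and O2: "\<lbrakk>x \<in> carrier R; y \<in> carrier R; x \<otimes> y \<preceq> \<zero>\<rbrakk> \<Longrightarrow> x \<preceq> \<zero> \<or> y \<preceq> \<zero>"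
    and O3: "\<lbrakk>x \<in> carrier R; y \<in> carrier R; z \<in> carrier R; x \<preceq> y; \<zero> \<preceq> z\<rbrakk>
      \<Longrightarrow> x \<otimes> z \<preceq> y \<otimes> z"
    and O4: "\<lbrakk>x \<in> carrier R; y \<in> carrier R; z \<in> carrier R; x \<preceq> y\<rbrakk> \<Longrightarrow> x \<oplus> z \<preceq> y \<oplus> z"

definition order_support ::
    "('a, 'm) ring_scheme \<Rightarrow> ('a \<Rightarrow> 'a \<Rightarrow> bool) \<Rightarrow> 'a set" where
  "order_support R leq = {x \<in> carrier R. leq x \<zero>\<^bsub>R\<^esub> \<and> leq \<zero>\<^bsub>R\<^esub> x}"

text \<open>
  Value groups are written multiplicatively, as all groups in HOL-Algebra are:
  \<open>\<otimes>\<close> and \<open>\<one>\<close> of the group play the role of addition and of the value \<open>0\<close>.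
\<close>

locale ordered_abelian_group = comm_group \<Gamma>
  for \<Gamma> :: "('g, 'n) monoid_scheme" (structure)
    and gle :: "'g \<Rightarrow> 'g \<Rightarrow> bool" (infix \<open>\<preceq>\<close> 50) +
  assumes gle_refl: "reflp_on (carrier \<Gamma>) (\<preceq>)"
    and gle_trans: "transp_on (carrier \<Gamma>) (\<preceq>)"
    and gle_antisym: "antisymp_on (carrier \<Gamma>) (\<preceq>)"
    and gle_total: "totalp_on (carrier \<Gamma>) (\<preceq>)"
    and gle_mult: "\<lbrakk>a \<in> carrier \<Gamma>; b \<in> carrier \<Gamma>; c \<in> carrier \<Gamma>; a \<preceq> b\<rbrakk> \<Longrightarrow> a \<otimes> c \<preceq> b \<otimes> c"

datatype 'g with_infinity = Fin 'g | Infinity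

fun inf_add ::
    "('g, 'n) monoid_scheme \<Rightarrow> 'g with_infinity \<Rightarrow> 'g with_infinity \<Rightarrow> 'g with_infinity" where
  "inf_add \<Gamma> (Fin a) (Fin b) = Fin (a \<otimes>\<^bsub>\<Gamma>\<^esub> b)"
| "inf_add \<Gamma> Infinity _ = Infinity"
| "inf_add \<Gamma> _ Infinity = Infinity"

fun inf_le :: "('g \<Rightarrow> 'g \<Rightarrow> bool) \<Rightarrow> 'g with_infinity \<Rightarrow> 'g with_infinity \<Rightarrow> bool" where
  "inf_le gle _ Infinity \<longleftrightarrow> True"
| "inf_le gle Infinity (Fin _) \<longleftrightarrow> False"
| "inf_le gle (Fin a) (Fin b) \<longleftrightarrow> gle a b"

definition inf_min ::
    "('g \<Rightarrow> 'g \<Rightarrow> bool) \<Rightarrow> 'g with_infinity \<Rightarrow> 'g with_infinity \<Rightarrow> 'g with_infinity" where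
  "inf_min gle s t = (if inf_le gle s t then s else t)"

locale ring_valuation = ring: cring R + group: ordered_abelian_group \<Gamma> gle
  for R :: "('a, 'm) ring_scheme" and \<Gamma> :: "('g, 'n) monoid_scheme"
    and gle :: "'g \<Rightarrow> 'g \<Rightarrow> bool" +
  fixes v :: "'a \<Rightarrow> 'g with_infinity"
  assumes val_closed: "x \<in> carrier R \<Longrightarrow> v x \<in> insert Infinity (Fin ` carrier \<Gamma>)"
    and val_zero: "v \<zero>\<^bsub>R\<^esub> = Infinity"
    and val_one: "v \<one>\<^bsub>R\<^esub> = Fin \<one>\<^bsub>\<Gamma>\<^esub>"
    and val_mult: "\<lbrakk>x \<in> carrier R; y \<in> carrier R\<rbrakk> \<Longrightarrow> v (x \<otimes>\<^bsub>R\<^esub> y) = inf_add \<Gamma> (v x) (v y)"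
    and val_add: "\<lbrakk>x \<in> carrier R; y \<in> carrier R\<rbrakk>
      \<Longrightarrow> inf_le gle (inf_min gle (v x) (v y)) (v (x \<oplus>\<^bsub>R\<^esub> y))"
    and val_generates: "carrier \<Gamma> = generate \<Gamma> {g. \<exists>x \<in> carrier R. v x = Fin g}"

definition valuation_support ::
    "('a, 'm) ring_scheme \<Rightarrow> ('a \<Rightarrow> 'g with_infinity) \<Rightarrow> 'a set" where
  "valuation_support R v = {x \<in> carrier R. v x = Infinity}"

text \<open>
  Since \<open>\<Gamma>\<close> is generated by the values of \<open>v\<close>, each \<open>g\<close> in \<open>carrier \<Gamma>\<close> is a difference of values and is
  determined by the set of pairs \<open>(a, b)\<close> with \<open>v a - v b = g\<close> (additively written). Hence every value
  group is isomorphic to one with elements of type \<open>('a \<times> 'a) set\<close>, and quantifying existentially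
  over value groups of that type loses no valuation.
\<close>

definition induced_by_valuation ::
    "('a, 'm) ring_scheme \<Rightarrow> ('a \<Rightarrow> 'a \<Rightarrow> bool) \<Rightarrow> ('g, 'n) monoid_scheme \<Rightarrow> ('g \<Rightarrow> 'g \<Rightarrow> bool)
      \<Rightarrow> ('a \<Rightarrow> 'g with_infinity) \<Rightarrow> bool" where
  "induced_by_valuation R leq \<Gamma> gle v \<longleftrightarrow>
    ring_valuation R \<Gamma> gle v \<and>
    (\<forall>x \<in> carrier R. \<forall>y \<in> carrier R. leq x y \<longleftrightarrow> inf_le gle (v y) (v x))"

end

theory Submission
  imports Defs
begin

text \<open>
  The sign of \<open>-1\<close> decides. If \<open>-1 \<preceq> 0\<close>, then \<open>x \<preceq> y\<close> is equivalent to \<open>0 \<preceq> y - x\<close> and the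
  nonnegative elements are closed under addition, so the quasi-order is an order. If \<open>0 \<preceq> -1\<close>,
  then \<open>-1 \<sim> 1\<close>, whence every \<open>x\<close> satisfies \<open>0 \<preceq> x \<sim> -x\<close>, and (QR4) forces
  \<open>x + y \<preceq> max x y\<close>. The elements outside the support then form a commutative monoid, totally
  preordered by the reverse of \<open>\<preceq>\<close> and cancellative up to \<open>\<sim>\<close> by (QR5); its group of fractions is the
  value group.
\<close>

section \<open>Ordered rings\<close>

text \<open>Only QR5 needs an argument: moving everything to one side gives
  \<open>(x - y)z \<preceq> 0\<close>, and O2 with \<open>z\<close> strictly positive leaves
  \<open>x - y \<preceq> 0\<close>.\<close>

lemma ord_ring_imp_quasi_ordered_ring:
  assumes "ord_ring R leq"
  shows "quasi_ordered_ring R leq"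
proof -
  interpret ord_ring R leq by fact
  show ?thesis
  proof
    show "reflp_on (carrier R) leq" "transp_on (carrier R) leq" "totalp_on (carrier R) leq"
      by (fact ord_refl ord_trans ord_total)+
    show "order_strict leq \<zero>\<^bsub>R\<^esub> \<one>\<^bsub>R\<^esub>" by (fact O1)
  next
    fix x y assume "x \<in> carrier R" "y \<in> carrier R" "leq (x \<otimes>\<^bsub>R\<^esub> y) \<zero>\<^bsub>R\<^esub>"
    then show "leq x \<zero>\<^bsub>R\<^esub> \<or> leq y \<zero>\<^bsub>R\<^esub>" by (rule O2)
  next
    fix x y z
    assume xyz: "x \<in> carrier R" "y \<in> carrier R" "z \<in> carrier R"
    show "leq (x \<otimes>\<^bsub>R\<^esub> z) (y \<otimes>\<^bsub>R\<^esub> z)" if "leq x y" "leq \<zero>\<^bsub>R\<^esub> z"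
      using xyz that by (rule O3)
    show "leq (x \<oplus>\<^bsub>R\<^esub> z) (y \<oplus>\<^bsub>R\<^esub> z)" if "leq x y"
      using xyz that by (rule O4)
    show "leq x y" if z: "order_strict leq \<zero>\<^bsub>R\<^esub> z" and le: "leq (x \<otimes>\<^bsub>R\<^esub> z) (y \<otimes>\<^bsub>R\<^esub> z)"
    proof -
      have "leq (x \<otimes>\<^bsub>R\<^esub> z \<oplus>\<^bsub>R\<^esub> \<ominus>\<^bsub>R\<^esub> (y \<otimes>\<^bsub>R\<^esub> z)) (y \<otimes>\<^bsub>R\<^esub> z \<oplus>\<^bsub>R\<^esub> \<ominus>\<^bsub>R\<^esub> (y \<otimes>\<^bsub>R\<^esub> z))"
        using xyz le by (intro O4) auto
      moreover have "x \<otimes>\<^bsub>R\<^esub> z \<oplus>\<^bsub>R\<^esub> \<ominus>\<^bsub>R\<^esub> (y \<otimes>\<^bsub>R\<^esub> z) = (x \<oplus>\<^bsub>R\<^esub> \<ominus>\<^bsub>R\<^esub> y) \<otimes>\<^bsub>R\<^esub> z"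
        "y \<otimes>\<^bsub>R\<^esub> z \<oplus>\<^bsub>R\<^esub> \<ominus>\<^bsub>R\<^esub> (y \<otimes>\<^bsub>R\<^esub> z) = \<zero>\<^bsub>R\<^esub>"
        using xyz by algebra+
      ultimately have "leq (x \<oplus>\<^bsub>R\<^esub> \<ominus>\<^bsub>R\<^esub> y) \<zero>\<^bsub>R\<^esub>"
        using O2[of "x \<oplus>\<^bsub>R\<^esub> \<ominus>\<^bsub>R\<^esub> y" z] xyz z by (auto simp: order_strict_def)
      then have "leq (x \<oplus>\<^bsub>R\<^esub> \<ominus>\<^bsub>R\<^esub> y \<oplus>\<^bsub>R\<^esub> y) (\<zero>\<^bsub>R\<^esub> \<oplus>\<^bsub>R\<^esub> y)"
        using xyz by (intro O4) auto
      moreover have "x \<oplus>\<^bsub>R\<^esub> \<ominus>\<^bsub>R\<^esub> y \<oplus>\<^bsub>R\<^esub> y = x" using xyz by algebra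
      ultimately show ?thesis using xyz by simp
    qed
  qed
qed

section \<open>The dichotomy for quasi-orders\<close>

context quasi_ordered_ring
begin

section \<open>Preorder facts and arithmetic of the support\<close>

abbreviation equivalent (infix \<open>\<sim>\<close> 50) where "x \<sim> y \<equiv> order_equiv (\<preceq>) x y"

lemma le_refl: "x \<in> carrier R \<Longrightarrow> x \<preceq> x"
  using qo_refl by (auto simp: reflp_on_def)

lemma le_trans:
  "\<lbrakk>x \<preceq> y; y \<preceq> z; x \<in> carrier R; y \<in> carrier R; z \<in> carrier R\<rbrakk> \<Longrightarrow> x \<preceq> z"
  using transp_onD[OF qo_trans] by blast

lemma le_linear: "\<lbrakk>x \<in> carrier R; y \<in> carrier R\<rbrakk> \<Longrightarrow> x \<preceq> y \<or> y \<preceq> x"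
  using qo_total le_refl by (cases "x = y") (auto simp: totalp_on_def)

lemma equiv_trans:
  "\<lbrakk>x \<sim> y; y \<sim> z; x \<in> carrier R; y \<in> carrier R; z \<in> carrier R\<rbrakk> \<Longrightarrow> x \<sim> z"
  unfolding order_equiv_def using le_trans by blast

lemma one_pos: "\<zero> \<preceq> \<one>" "\<not> \<one> \<preceq> \<zero>"
  using QR1 by (auto simp: order_strict_def)

text \<open>If \<open>\<ominus> x\<close> were outside the support, it would be equivalent to
  neither \<open>x\<close> nor \<open>\<zero>\<close>. QR4 could then add it to both inequalities in
  \<open>x \<sim> \<zero>\<close>, which puts it in the support after all.\<close>

lemma support_uminus:
  assumes "x \<in> carrier R" "x \<sim> \<zero>"
  shows "\<ominus> x \<sim> \<zero>"
proof (rule ccontr)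
  assume neg: "\<not> \<ominus> x \<sim> \<zero>"
  moreover have "\<not> \<ominus> x \<sim> x"
    using neg assms equiv_trans[of "\<ominus> x" x \<zero>] by auto
  ultimately have "\<zero> \<preceq> \<ominus> x" "\<ominus> x \<preceq> \<zero>"
    using assms QR4[of x \<zero> "\<ominus> x"] QR4[of \<zero> x "\<ominus> x"]
    by (auto simp: order_equiv_def r_neg)
  with neg show False by (simp add: order_equiv_def)
qed

text \<open>Since \<open>x\<close> is equivalent to neither \<open>e\<close> nor
  \<open>\<zero>\<close>, QR4 may add it to both inequalities in
  \<open>e \<sim> \<zero>\<close>.\<close>

lemma add_support_equiv:
  assumes "x \<in> carrier R" "e \<in> carrier R" "e \<sim> \<zero>" "\<not> x \<sim> \<zero>"
  shows "x \<oplus> e \<sim> x"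
proof -
  have "\<not> x \<sim> e" using assms equiv_trans[of x e \<zero>] by auto
  then show ?thesis
    using assms QR4[of e \<zero> x] QR4[of \<zero> e x]
    by (auto simp: order_equiv_def a_comm)
qed

text \<open>Were \<open>x \<oplus> y\<close> outside the support, subtracting the support element
  \<open>y\<close> would not change its class, so \<open>x\<close> would be outside too.\<close>

lemma support_add:
  assumes "x \<in> carrier R" "y \<in> carrier R" "x \<sim> \<zero>" "y \<sim> \<zero>"
  shows "x \<oplus> y \<sim> \<zero>"
proof (rule ccontr)
  assume neg: "\<not> x \<oplus> y \<sim> \<zero>"
  have "x \<oplus> y \<oplus> \<ominus> y \<sim> x \<oplus> y"
    using assms neg support_uminus[of y] by (intro add_support_equiv) auto
  moreover have "x \<oplus> y \<oplus> \<ominus> y = x" using assms by algebra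
  ultimately show False
    using neg assms equiv_trans[of "x \<oplus> y" x \<zero>] by (auto simp: order_equiv_def)
qed

text \<open>The converse fails in general: for a quasi-order coming from a valuation, every element
  is nonnegative.\<close>

lemma uminus_nonneg:
  assumes "x \<in> carrier R" "x \<preceq> \<zero>"
  shows "\<zero> \<preceq> \<ominus> x"
proof (cases "\<ominus> x \<sim> \<zero>")
  case True
  then show ?thesis by (simp add: order_equiv_def)
next
  case False
  then show ?thesis using assms QR4[of x \<zero> "\<ominus> x"] by (auto simp: r_neg)
qed

text \<open>QR2 settles nonnegative factors. In general one of \<open>x\<close>,
  \<open>\<ominus> x\<close> and one of \<open>y\<close>, \<open>\<ominus> y\<close> is nonnegative,
  and sign changes affect neither hypothesis nor conclusion.\<close>

lemma support_prime:
  assumes "x \<in> carrier R" "y \<in> carrier R" "x \<otimes> y \<sim> \<zero>"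
  shows "x \<sim> \<zero> \<or> y \<sim> \<zero>"
proof -
  have *: "x \<sim> \<zero> \<or> y \<sim> \<zero>"
    if "x \<in> carrier R" "y \<in> carrier R" "x \<otimes> y \<sim> \<zero>" "\<zero> \<preceq> x" "\<zero> \<preceq> y" for x y
    using that QR2[of x y] by (auto simp: order_equiv_def)
  have pm: "x \<sim> \<zero> \<longleftrightarrow> \<ominus> x \<sim> \<zero>" if "x \<in> carrier R" for x
    using that support_uminus[of x] support_uminus[of "\<ominus> x"] by auto
  have "\<ominus> (x \<otimes> y) \<sim> \<zero>" using assms support_uminus by simp
  then have neg: "\<ominus> x \<otimes> y \<sim> \<zero>" "x \<otimes> \<ominus> y \<sim> \<zero>" "\<ominus> x \<otimes> \<ominus> y \<sim> \<zero>"
    using assms by (simp_all add: l_minus r_minus)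
  consider "\<zero> \<preceq> x" | "\<zero> \<preceq> \<ominus> x" using assms uminus_nonneg le_linear by blast
  moreover consider "\<zero> \<preceq> y" | "\<zero> \<preceq> \<ominus> y" using assms uminus_nonneg le_linear by blast
  ultimately show ?thesis
    using assms neg *[of x y] *[of "\<ominus> x" y] *[of x "\<ominus> y"] *[of "\<ominus> x" "\<ominus> y"]
      pm[of x] pm[of y] by (metis a_inv_closed)
qed

text \<open>Only O4 is at stake. It follows once \<open>x \<preceq> y\<close> is reduced to the sign
  of \<open>y - x\<close>; the work lies in the cases where the side condition of QR4 fails.\<close>

lemma ord_ring_if_minus_one_neg:
  assumes "\<ominus> \<one> \<preceq> \<zero>"
  shows "ord_ring R (\<preceq>)"
proof -
  have uminus_nonpos: "\<ominus> x \<preceq> \<zero>" if "x \<in> carrier R" "\<zero> \<preceq> x" for x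
    using QR3[OF _ _ _ assms that(2)] that by (simp add: l_minus)
  have add_nonneg: "\<zero> \<preceq> x \<oplus> y"
    if xy: "x \<in> carrier R" "y \<in> carrier R" "\<zero> \<preceq> x" "\<zero> \<preceq> y" for x y
  proof (cases "x \<sim> y")
    case False
    \<comment> \<open>Here \<open>\<ominus> x \<preceq> \<zero> \<preceq> y\<close>, and
      \<open>x\<close> may be added because it is not equivalent to \<open>y\<close>.\<close>
    have "\<ominus> x \<preceq> y" using xy uminus_nonpos le_trans[of "\<ominus> x" \<zero> y] by auto
    then show ?thesis using False xy QR4[of "\<ominus> x" y x] by (auto simp: r_neg a_comm)
  next
    case True
    show ?thesis
    proof (rule ccontr)
      assume neg: "\<not> \<zero> \<preceq> x \<oplus> y"
      \<comment> \<open>A negative sum forces \<open>y\<close> out of the support. Then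
        \<open>\<ominus> y\<close> may be added to \<open>x \<oplus> y \<preceq> \<zero>\<close>, so
        \<open>x \<preceq> \<ominus> y \<preceq> \<zero>\<close>. This puts \<open>x\<close>, and
        with it the equivalent \<open>y\<close>, into the support.\<close>
      have "\<not> y \<sim> \<zero>"
        using neg xy True support_add[of x y] equiv_trans[of x y \<zero>] by (auto simp: order_equiv_def)
      then have ny: "\<not> \<ominus> y \<sim> \<zero>" using xy support_uminus[of "\<ominus> y"] by auto
      have "x \<oplus> y \<oplus> \<ominus> y = x" using xy by algebra
      then have "x \<preceq> \<ominus> y"
        using neg ny xy le_linear[of "x \<oplus> y" \<zero>] QR4[of "x \<oplus> y" \<zero> "\<ominus> y"] by auto
      then have "x \<preceq> \<zero>" using xy uminus_nonpos le_trans[of x "\<ominus> y" \<zero>] by auto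
      then have "x \<sim> \<zero>" using xy by (simp add: order_equiv_def)
      then show False using True \<open>\<not> y \<sim> \<zero>\<close> xy equiv_trans[of y x \<zero>]
        by (auto simp: order_equiv_def)
    qed
  qed
  have diff_nonneg: "\<zero> \<preceq> y \<oplus> \<ominus> x" if xy: "x \<in> carrier R" "y \<in> carrier R" "x \<preceq> y" for x y
  proof (cases "\<ominus> x \<sim> y")
    case False
    then show ?thesis using xy QR4[of x y "\<ominus> x"] by (auto simp: r_neg)
  next
    case True
    \<comment> \<open>QR4 cannot add \<open>\<ominus> x\<close> to \<open>x \<preceq> y\<close> when
      \<open>\<ominus> x \<sim> y\<close>. Instead \<open>\<ominus> x\<close> and \<open>y\<close>
      are both shown nonnegative, so that \<open>add_nonneg\<close> applies to their sum.\<close>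
    have "\<zero> \<preceq> \<ominus> x"
    proof (cases "x \<preceq> \<zero>")
      case True
      then show ?thesis using xy uminus_nonneg by auto
    next
      case False
      then have x: "\<zero> \<preceq> x" using xy le_linear by blast
      have "x \<preceq> \<ominus> x" using xy True le_trans[of x y "\<ominus> x"] by (auto simp: order_equiv_def)
      then show ?thesis using x xy le_trans[of \<zero> x "\<ominus> x"] by auto
    qed
    moreover from this have "\<zero> \<preceq> y"
      using xy True le_trans[of \<zero> "\<ominus> x" y] by (auto simp: order_equiv_def)
    ultimately show ?thesis using xy add_nonneg by auto
  qed
  have le_if_diff_nonneg: "x \<preceq> y"
    if xy: "x \<in> carrier R" "y \<in> carrier R" and d: "\<zero> \<preceq> y \<oplus> \<ominus> x" for x y
  proof (rule ccontr)
    assume neg: "\<not> x \<preceq> y"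
    then have "\<zero> \<preceq> x \<oplus> \<ominus> y" using xy diff_nonneg le_linear by blast
    then have "\<ominus> (x \<oplus> \<ominus> y) \<preceq> \<zero>" using xy uminus_nonpos by auto
    moreover have "\<ominus> (x \<oplus> \<ominus> y) = y \<oplus> \<ominus> x" using xy by algebra
    \<comment> \<open>The two opposite differences are both nonnegative, so \<open>y - x\<close>
      lies in the support. Adding it to \<open>x\<close> cannot leave the class of \<open>x\<close>,
      which contradicts \<open>neg\<close>.\<close>
    ultimately have e: "y \<oplus> \<ominus> x \<sim> \<zero>" using d by (simp add: order_equiv_def)
    have s: "x \<oplus> (y \<oplus> \<ominus> x) = y" using xy by algebra
    show False
    proof (cases "x \<sim> \<zero>")
      case True
      then have "y \<sim> \<zero>" using support_add[OF _ _ True e] s xy by auto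
      then show False using neg True xy le_trans[of x \<zero> y] by (auto simp: order_equiv_def)
    next
      case False
      then show False using add_support_equiv[OF _ _ e False] s neg xy
        by (auto simp: order_equiv_def)
    qed
  qed
  show ?thesis
  proof
    show "reflp_on (carrier R) (\<preceq>)" "transp_on (carrier R) (\<preceq>)" "totalp_on (carrier R) (\<preceq>)"
      by (fact qo_refl qo_trans qo_total)+
    show "order_strict (\<preceq>) \<zero> \<one>" by (fact QR1)
  next
    fix x y assume "x \<in> carrier R" "y \<in> carrier R" "x \<otimes> y \<preceq> \<zero>"
    then show "x \<preceq> \<zero> \<or> y \<preceq> \<zero>" by (rule QR2)
  next
    fix x y z assume xyz: "x \<in> carrier R" "y \<in> carrier R" "z \<in> carrier R" "x \<preceq> y"
    show "x \<otimes> z \<preceq> y \<otimes> z" if "\<zero> \<preceq> z" using xyz that by (rule QR3)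
    have "y \<oplus> z \<oplus> \<ominus> (x \<oplus> z) = y \<oplus> \<ominus> x" using xyz(1-3) by algebra
    then show "x \<oplus> z \<preceq> y \<oplus> z"
      using diff_nonneg[of x y] le_if_diff_nonneg[of "x \<oplus> z" "y \<oplus> z"] xyz by simp
  qed
qed

section \<open>The case \<open>\<zero> \<preceq> \<ominus> \<one>\<close>: signs disappear and the
  ultrametric inequality holds\<close>

lemma minus_one_equiv_one:
  assumes "\<zero> \<preceq> \<ominus> \<one>"
  shows "\<ominus> \<one> \<sim> \<one>"
proof (rule ccontr)
  assume "\<not> \<ominus> \<one> \<sim> \<one>"
  then have "\<one> \<preceq> \<zero>"
    using assms QR4[of \<zero> "\<ominus> \<one>" \<one>] by (auto simp: l_neg order_equiv_def)
  then show False using one_pos by simp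
qed

text \<open>For nonnegative \<open>y\<close>, QR3 multiplies
  \<open>\<ominus> \<one> \<sim> \<one>\<close> by \<open>y\<close>. If
  \<open>x \<preceq> \<zero>\<close>, this is applied to the nonnegative element
  \<open>\<ominus> x\<close>.\<close>

lemma uminus_equiv:
  assumes "\<zero> \<preceq> \<ominus> \<one>" "x \<in> carrier R"
  shows "\<ominus> x \<sim> x"
proof -
  have pos: "\<ominus> y \<sim> y" if "y \<in> carrier R" "\<zero> \<preceq> y" for y
    using minus_one_equiv_one[OF assms(1)] QR3[of "\<ominus> \<one>" \<one> y] QR3[of \<one> "\<ominus> \<one>" y] that
    by (auto simp: order_equiv_def l_minus)
  show ?thesis
    using pos[of x] pos[of "\<ominus> x"] assms(2) le_linear[of \<zero> x] uminus_nonneg[of x]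
    by (auto simp: order_equiv_def)
qed

lemma all_nonneg:
  assumes "\<zero> \<preceq> \<ominus> \<one>" "x \<in> carrier R"
  shows "\<zero> \<preceq> x"
  using uminus_equiv[OF assms] uminus_nonneg[of x] le_linear[of \<zero> x] le_trans[of \<zero> "\<ominus> x" x] assms
  by (auto simp: order_equiv_def)

text \<open>As \<open>x\<close> is equivalent to neither of \<open>y \<sim> \<ominus> y\<close>, QR4
  adds it to both inequalities.\<close>

lemma add_equiv_diff:
  assumes "\<zero> \<preceq> \<ominus> \<one>" "x \<in> carrier R" "y \<in> carrier R" "\<not> x \<sim> y"
  shows "x \<oplus> y \<sim> x \<oplus> \<ominus> y"
proof -
  have y: "\<ominus> y \<sim> y" using assms uminus_equiv by blast
  then have "\<not> x \<sim> \<ominus> y" using assms equiv_trans[of x "\<ominus> y" y] by auto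
  then show ?thesis
    using y assms QR4[of y "\<ominus> y" x] QR4[of "\<ominus> y" y x] by (auto simp: order_equiv_def a_comm)
qed

text \<open>The strong triangle inequality in reversed order; it supplies \<open>val_add\<close> for
  the valuation built later.\<close>

lemma ultrametric:
  assumes m: "\<zero> \<preceq> \<ominus> \<one>" and xy: "x \<in> carrier R" "y \<in> carrier R" "x \<preceq> y"
  shows "x \<oplus> y \<preceq> y"
proof (rule ccontr)
  assume neg: "\<not> x \<oplus> y \<preceq> y"
  then have y: "y \<preceq> x \<oplus> y" using xy le_linear by blast
  have x: "x \<preceq> x \<oplus> y" using xy y le_trans[of x y "x \<oplus> y"] by auto
  show False
  proof (cases "x \<sim> y")
    case False
    \<comment> \<open>The sum is strictly above \<open>y \<sim> \<ominus> y\<close>, so QR4 may add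
      \<open>\<ominus> y\<close> to \<open>x \<preceq> x \<oplus> y\<close>. The result
      \<open>x - y \<preceq> x\<close> becomes \<open>x \<oplus> y \<preceq> x\<close> by
      \<open>add_equiv_diff\<close>.\<close>
    have "\<not> \<ominus> y \<sim> x \<oplus> y"
      using neg xy uminus_equiv[OF m, of y] le_trans[of "x \<oplus> y" "\<ominus> y" y]
      by (auto simp: order_equiv_def)
    moreover have "x \<oplus> y \<oplus> \<ominus> y = x" using xy by algebra
    ultimately have "x \<oplus> \<ominus> y \<preceq> x"
      using x xy QR4[of x "x \<oplus> y" "\<ominus> y"] by auto
    then have "x \<oplus> y \<preceq> x"
      using add_equiv_diff[OF m _ _ False] xy le_trans[of "x \<oplus> y" "x \<oplus> \<ominus> y" x]
      by (auto simp: order_equiv_def)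
    then show False using neg xy le_trans[of "x \<oplus> y" x y] by auto
  next
    case True
    \<comment> \<open>Here \<open>x + 2y \<sim> x\<close>, while adding \<open>y\<close> to \<open>x \<preceq> x + y\<close> gives \<open>x + y \<preceq> x + 2y\<close>.\<close>
    have ny: "\<not> x \<oplus> y \<sim> y" using neg by (simp add: order_equiv_def)
    have "x \<oplus> y \<oplus> \<ominus> y = x" using xy by algebra
    then have 1: "x \<oplus> y \<oplus> y \<sim> x" using add_equiv_diff[OF m _ _ ny] xy by auto
    have "x \<oplus> y \<preceq> x \<oplus> y \<oplus> y"
      using ny x xy by (intro QR4[of x "x \<oplus> y" y]) (auto simp: order_equiv_def)
    then have "x \<oplus> y \<preceq> x"
      using 1 xy le_trans[of "x \<oplus> y" "x \<oplus> y \<oplus> y" x] by (auto simp: order_equiv_def)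
    then show False using neg xy le_trans[of "x \<oplus> y" x y] by auto
  qed
qed

end

section \<open>Quasi-orders from valuations\<close>

lemma inf_leD: "inf_le gle Infinity s \<Longrightarrow> s = Infinity"
  by (cases s) auto

section \<open>Ordered abelian groups and their extension by infinity\<close>

context ordered_abelian_group
begin

lemma le_mult_cancel:
  assumes "a \<in> carrier \<Gamma>" "b \<in> carrier \<Gamma>" "c \<in> carrier \<Gamma>" "a \<otimes> c \<preceq> b \<otimes> c"
  shows "a \<preceq> b"
  using gle_mult[of "a \<otimes> c" "b \<otimes> c" "inv c"] assms by (simp add: m_assoc)

lemma gle_linear: "\<lbrakk>a \<in> carrier \<Gamma>; b \<in> carrier \<Gamma>\<rbrakk> \<Longrightarrow> a \<preceq> b \<or> b \<preceq> a"
  using gle_total gle_refl by (cases "a = b") (auto simp: totalp_on_def reflp_on_def)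

text \<open>An ordered group has no element of order two: multiplying
  \<open>a \<preceq> \<one>\<close> by \<open>a\<close> reverses the inequality, and likewise for
  \<open>\<one> \<preceq> a\<close>.\<close>

lemma square_eq_one:
  assumes "a \<in> carrier \<Gamma>" "a \<otimes> a = \<one>"
  shows "a = \<one>"
proof -
  have "a \<preceq> \<one> \<or> \<one> \<preceq> a" using assms gle_linear by simp
  then show ?thesis
    using gle_mult[of a \<one> a] gle_mult[of \<one> a a] antisymp_onD[OF gle_antisym, of a \<one>] assms
    by auto
qed

abbreviation "value_set \<equiv> insert Infinity (Fin ` carrier \<Gamma>)"

lemma inf_le_refl: "s \<in> value_set \<Longrightarrow> inf_le (\<preceq>) s s"
  using gle_refl by (cases s) (auto simp: reflp_on_def)

lemma inf_le_trans:
  assumes "inf_le (\<preceq>) r s" "inf_le (\<preceq>) s t" "r \<in> value_set" "s \<in> value_set" "t \<in> value_set"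
  shows "inf_le (\<preceq>) r t"
proof (cases "\<exists>a b c. r = Fin a \<and> s = Fin b \<and> t = Fin c")
  case True
  then obtain a b c where "r = Fin a" "s = Fin b" "t = Fin c" by blast
  then show ?thesis using assms transp_onD[OF gle_trans, of a b c] by auto
next
  case False
  then show ?thesis using assms by (cases r; cases s; cases t) auto
qed

lemma inf_le_linear: "\<lbrakk>s \<in> value_set; t \<in> value_set\<rbrakk> \<Longrightarrow> inf_le (\<preceq>) s t \<or> inf_le (\<preceq>) t s"
  using gle_linear by (cases s; cases t) auto

lemma inf_le_antisym:
  "\<lbrakk>inf_le (\<preceq>) s t; inf_le (\<preceq>) t s; s \<in> value_set; t \<in> value_set\<rbrakk> \<Longrightarrow> s = t"
  using antisymp_onD[OF gle_antisym] by (cases s; cases t) auto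

lemma inf_add_mono:
  assumes "inf_le (\<preceq>) s t" "r \<in> value_set" "s \<in> value_set" "t \<in> value_set"
  shows "inf_le (\<preceq>) (inf_add \<Gamma> s r) (inf_add \<Gamma> t r)"
  using assms gle_mult by (cases r; cases s; cases t) auto

lemma inf_add_cancel:
  assumes "inf_le (\<preceq>) (inf_add \<Gamma> s r) (inf_add \<Gamma> t r)" "r \<noteq> Infinity"
    "r \<in> value_set" "s \<in> value_set" "t \<in> value_set"
  shows "inf_le (\<preceq>) s t"
  using assms by (cases r; cases s; cases t) (auto dest: le_mult_cancel[rotated 3])

end

lemma inf_add_eq_Infinity: "inf_add \<Gamma> s t = Infinity \<Longrightarrow> s = Infinity \<or> t = Infinity"
  by (cases s; cases t) auto

section \<open>Calculus of valuations and the quasi-orders they induce\<close>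

context ring_valuation
begin

abbreviation value_le (infix \<open>\<le>\<^sub>v\<close> 50) where "s \<le>\<^sub>v t \<equiv> inf_le gle s t"

text \<open>The square of \<open>-1\<close> is \<open>1\<close>, so its value squares to the
  identity of an ordered group.\<close>

lemma val_minus_one: "v (\<ominus>\<^bsub>R\<^esub> \<one>\<^bsub>R\<^esub>) = Fin \<one>\<^bsub>\<Gamma>\<^esub>"
proof -
  have "inf_add \<Gamma> (v (\<ominus>\<^bsub>R\<^esub> \<one>\<^bsub>R\<^esub>)) (v (\<ominus>\<^bsub>R\<^esub> \<one>\<^bsub>R\<^esub>)) = Fin \<one>\<^bsub>\<Gamma>\<^esub>"
    using val_mult[of "\<ominus>\<^bsub>R\<^esub> \<one>\<^bsub>R\<^esub>" "\<ominus>\<^bsub>R\<^esub> \<one>\<^bsub>R\<^esub>"] val_one by (simp add: ring.l_minus)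
  then show ?thesis
    using val_closed[of "\<ominus>\<^bsub>R\<^esub> \<one>\<^bsub>R\<^esub>"] group.square_eq_one by (cases "v (\<ominus>\<^bsub>R\<^esub> \<one>\<^bsub>R\<^esub>)") auto
qed

lemma val_uminus:
  assumes "x \<in> carrier R"
  shows "v (\<ominus>\<^bsub>R\<^esub> x) = v x"
proof -
  have "v (\<ominus>\<^bsub>R\<^esub> x) = inf_add \<Gamma> (Fin \<one>\<^bsub>\<Gamma>\<^esub>) (v x)"
    using val_mult[of "\<ominus>\<^bsub>R\<^esub> \<one>\<^bsub>R\<^esub>" x] val_minus_one assms by (simp add: ring.l_minus)
  also have "\<dots> = v x"
    using val_closed[OF assms] by (cases "v x") auto
  finally show ?thesis .
qed

text \<open>A form of \<open>val_add\<close> with an arbitrary common lower bound, which spares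
  later proofs the minimum.\<close>

lemma val_add_ge:
  assumes "x \<in> carrier R" "y \<in> carrier R" "t \<in> group.value_set" "t \<le>\<^sub>v v x" "t \<le>\<^sub>v v y"
  shows "t \<le>\<^sub>v v (x \<oplus>\<^bsub>R\<^esub> y)"
proof (rule group.inf_le_trans)
  show "inf_min gle (v x) (v y) \<le>\<^sub>v v (x \<oplus>\<^bsub>R\<^esub> y)" using assms val_add by blast
  show "t \<le>\<^sub>v inf_min gle (v x) (v y)" using assms by (simp add: inf_min_def)
qed (use assms val_closed in \<open>auto simp: inf_min_def\<close>)

lemma val_add_cancel:
  assumes "x \<in> carrier R" "y \<in> carrier R" "t \<in> group.value_set"
    "t \<le>\<^sub>v v (x \<oplus>\<^bsub>R\<^esub> y)" "t \<le>\<^sub>v v y"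
  shows "t \<le>\<^sub>v v x"
proof -
  have "x \<oplus>\<^bsub>R\<^esub> y \<oplus>\<^bsub>R\<^esub> \<ominus>\<^bsub>R\<^esub> y = x" using assms by algebra
  then show ?thesis
    using val_add_ge[of "x \<oplus>\<^bsub>R\<^esub> y" "\<ominus>\<^bsub>R\<^esub> y" t] val_uminus assms by auto
qed

text \<open>Together with \<open>val_add\<close> this says that a sum of elements with distinct
  values has exactly the smaller value.\<close>

lemma val_add_le:
  assumes xy: "x \<in> carrier R" "y \<in> carrier R" and neq: "v x \<noteq> v y"
  shows "v (x \<oplus>\<^bsub>R\<^esub> y) \<le>\<^sub>v v x"
proof (rule ccontr)
  let ?s = "x \<oplus>\<^bsub>R\<^esub> y"
  have vals: "v x \<in> group.value_set" "v y \<in> group.value_set" "v ?s \<in> group.value_set"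
    using xy val_closed by auto
  assume neg: "\<not> v ?s \<le>\<^sub>v v x"
  then have s: "v x \<le>\<^sub>v v ?s" using vals group.inf_le_linear by blast
  have "\<not> v y \<le>\<^sub>v v x"
  proof
    assume yx: "v y \<le>\<^sub>v v x"
    have "v x \<le>\<^sub>v v y"
      using val_add_cancel[of y x "v x"] s vals xy group.inf_le_refl ring.a_comm by simp
    with yx neq vals group.inf_le_antisym show False by blast
  qed
  \<comment> \<open>Since \<open>x\<close> is the difference of the sum and \<open>y\<close>, the
    smaller of their two values bounds \<open>v x\<close> from below.\<close>
  moreover have "v y \<le>\<^sub>v v x \<or> v ?s \<le>\<^sub>v v x"
    using vals xy group.inf_le_linear[of "v y" "v ?s"] val_add_cancel[of x y "v y"]
      val_add_cancel[of x y "v ?s"] group.inf_le_refl by blast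
  ultimately show False using neg by blast
qed

lemma quasi_ordered_ring_if_induced:
  assumes leq: "\<And>x y. \<lbrakk>x \<in> carrier R; y \<in> carrier R\<rbrakk> \<Longrightarrow> leq x y \<longleftrightarrow> v y \<le>\<^sub>v v x"
  shows "quasi_ordered_ring R leq"
proof
  have vals: "v x \<in> group.value_set" if "x \<in> carrier R" for x using that val_closed by blast
  show "reflp_on (carrier R) leq"
    using leq vals group.inf_le_refl by (auto intro!: reflp_onI)
  show "transp_on (carrier R) leq"
    using leq vals group.inf_le_trans by (intro transp_onI) metis
  show "totalp_on (carrier R) leq"
    using leq vals group.inf_le_linear by (intro totalp_onI) metis
  show "order_strict leq \<zero>\<^bsub>R\<^esub> \<one>\<^bsub>R\<^esub>"
    using leq val_zero val_one by (simp add: order_strict_def)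
next
  fix x y assume "x \<in> carrier R" "y \<in> carrier R" "leq (x \<otimes>\<^bsub>R\<^esub> y) \<zero>\<^bsub>R\<^esub>"
  then show "leq x \<zero>\<^bsub>R\<^esub> \<or> leq y \<zero>\<^bsub>R\<^esub>"
    using leq val_zero val_mult inf_leD[of gle "v (x \<otimes>\<^bsub>R\<^esub> y)"] inf_add_eq_Infinity[of \<Gamma> "v x" "v y"]
    by auto
next
  have vals: "v x \<in> group.value_set" if "x \<in> carrier R" for x using that val_closed by blast
  fix x y z assume xyz: "x \<in> carrier R" "y \<in> carrier R" "z \<in> carrier R"
  show "leq (x \<otimes>\<^bsub>R\<^esub> z) (y \<otimes>\<^bsub>R\<^esub> z)" if "leq x y"
    using that xyz leq vals group.inf_add_mono val_mult by simp
  show "leq x y" if z: "order_strict leq \<zero>\<^bsub>R\<^esub> z" and le: "leq (x \<otimes>\<^bsub>R\<^esub> z) (y \<otimes>\<^bsub>R\<^esub> z)"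
  proof -
    have "v z \<noteq> Infinity" using z xyz leq val_zero by (auto simp: order_strict_def)
    then show ?thesis
      using le xyz leq vals group.inf_add_cancel[of "v y" "v z" "v x"] val_mult by auto
  qed
  \<comment> \<open>The side condition of QR4 says that \<open>v z\<close> and \<open>v y\<close>
    differ, so \<open>v (y + z)\<close> is at most both of them. Being also at most
    \<open>v x\<close>, it is a common lower bound for \<open>v x\<close> and \<open>v z\<close>,
    hence for \<open>v (x + z)\<close>.\<close>
  show "leq (x \<oplus>\<^bsub>R\<^esub> z) (y \<oplus>\<^bsub>R\<^esub> z)" if le: "leq x y" and z: "\<not> order_equiv leq z y"
  proof -
    have "v z \<noteq> v y" using z xyz leq vals group.inf_le_refl by (auto simp: order_equiv_def)
    then have "v (y \<oplus>\<^bsub>R\<^esub> z) \<le>\<^sub>v v y" "v (y \<oplus>\<^bsub>R\<^esub> z) \<le>\<^sub>v v z"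
      using val_add_le[of y z] val_add_le[of z y] xyz ring.a_comm[of y z] by auto
    moreover from this have "v (y \<oplus>\<^bsub>R\<^esub> z) \<le>\<^sub>v v x"
      using le xyz leq vals group.inf_le_trans[of _ "v y" "v x"] by simp
    ultimately show ?thesis using val_add_ge[of x z] xyz vals leq by simp
  qed
qed

text \<open>The infinite value of \<open>0\<close> gives \<open>0 \<preceq> -1\<close>; adding
  \<open>1\<close> as O4 allows would give \<open>1 \<preceq> 0\<close>. Hence the two alternatives
  of the theorem exclude each other.\<close>

lemma not_ord_ring_if_induced:
  assumes leq: "\<And>x y. \<lbrakk>x \<in> carrier R; y \<in> carrier R\<rbrakk> \<Longrightarrow> leq x y \<longleftrightarrow> v y \<le>\<^sub>v v x"
  shows "\<not> ord_ring R leq"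
proof
  assume "ord_ring R leq"
  then interpret ord_ring R leq .
  have "leq (\<zero>\<^bsub>R\<^esub> \<oplus>\<^bsub>R\<^esub> \<one>\<^bsub>R\<^esub>) (\<ominus>\<^bsub>R\<^esub> \<one>\<^bsub>R\<^esub> \<oplus>\<^bsub>R\<^esub> \<one>\<^bsub>R\<^esub>)"
    using leq val_zero by (intro O4) auto
  then have "leq \<one>\<^bsub>R\<^esub> \<zero>\<^bsub>R\<^esub>" by (simp add: ring.l_neg)
  with O1 show False by (simp add: order_strict_def)
qed

lemma support_if_induced:
  assumes leq: "\<And>x y. \<lbrakk>x \<in> carrier R; y \<in> carrier R\<rbrakk> \<Longrightarrow> leq x y \<longleftrightarrow> v y \<le>\<^sub>v v x"
  shows "quasi_order_support R leq = valuation_support R v"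
  using leq val_zero inf_leD[of gle "v _"]
  by (auto simp: quasi_order_support_def valuation_support_def order_equiv_def)

end

section \<open>Valuations from quasi-orders\<close>

locale total_preordered_monoid = comm_monoid M
  for M :: "('a, 'm) monoid_scheme" (structure) and leq :: "'a \<Rightarrow> 'a \<Rightarrow> bool" (infix \<open>\<preceq>\<close> 50) +
  assumes po_refl: "reflp_on (carrier M) (\<preceq>)"
    and po_trans: "transp_on (carrier M) (\<preceq>)"
    and po_total: "totalp_on (carrier M) (\<preceq>)"
    and mult_le_iff:
      "\<lbrakk>x \<in> carrier M; y \<in> carrier M; z \<in> carrier M\<rbrakk> \<Longrightarrow> x \<otimes> z \<preceq> y \<otimes> z \<longleftrightarrow> x \<preceq> y"
begin

text \<open>A pair \<open>(a, b)\<close> stands for the fraction \<open>a / b\<close>.\<close>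

abbreviation "fracs \<equiv> carrier M \<times> carrier M"

definition frac_le :: "'a \<times> 'a \<Rightarrow> 'a \<times> 'a \<Rightarrow> bool" (infix \<open>\<unlhd>\<close> 50)
  where "p \<unlhd> q \<longleftrightarrow> fst p \<otimes> snd q \<preceq> fst q \<otimes> snd p"

definition frac_mult :: "'a \<times> 'a \<Rightarrow> 'a \<times> 'a \<Rightarrow> 'a \<times> 'a" (infixl \<open>\<odot>\<close> 70)
  where "p \<odot> q = (fst p \<otimes> fst q, snd p \<otimes> snd q)"

lemma frac_mult_closed: "\<lbrakk>p \<in> fracs; q \<in> fracs\<rbrakk> \<Longrightarrow> p \<odot> q \<in> fracs"
  by (auto simp: frac_mult_def)

lemma frac_mult_comm: "\<lbrakk>p \<in> fracs; q \<in> fracs\<rbrakk> \<Longrightarrow> p \<odot> q = q \<odot> p"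
  by (auto simp: frac_mult_def m_comm)

lemma frac_mult_assoc: "\<lbrakk>p \<in> fracs; q \<in> fracs; r \<in> fracs\<rbrakk> \<Longrightarrow> p \<odot> q \<odot> r = p \<odot> (q \<odot> r)"
  by (auto simp: frac_mult_def m_assoc)

lemma frac_le_refl: "p \<in> fracs \<Longrightarrow> p \<unlhd> p"
  using reflp_onD[OF po_refl] by (auto simp: frac_le_def)

lemma frac_le_linear: "\<lbrakk>p \<in> fracs; q \<in> fracs\<rbrakk> \<Longrightarrow> p \<unlhd> q \<or> q \<unlhd> p"
  using totalp_onD[OF po_total, of "fst p \<otimes> snd q" "fst q \<otimes> snd p"]
    reflp_onD[OF po_refl, of "fst p \<otimes> snd q"]
  by (cases "fst p \<otimes> snd q = fst q \<otimes> snd p") (auto simp: frac_le_def)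

text \<open>Each inequality is multiplied by the denominator missing from it; after chaining, the
  middle denominator cancels by \<open>mult_le_iff\<close>.\<close>

lemma frac_le_trans:
  assumes "p \<unlhd> q" "q \<unlhd> r" "p \<in> fracs" "q \<in> fracs" "r \<in> fracs"
  shows "p \<unlhd> r"
proof -
  obtain a b c d e f where pqr: "p = (a, b)" "q = (c, d)" "r = (e, f)"
    by (cases p; cases q; cases r)
  then have m: "a \<in> carrier M" "b \<in> carrier M" "c \<in> carrier M" "d \<in> carrier M"
    "e \<in> carrier M" "f \<in> carrier M"
    using assms by auto
  have "(a \<otimes> d) \<otimes> f \<preceq> (c \<otimes> b) \<otimes> f" "(c \<otimes> f) \<otimes> b \<preceq> (e \<otimes> d) \<otimes> b"
    using assms m pqr by (auto simp: mult_le_iff frac_le_def)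
  moreover have "(a \<otimes> d) \<otimes> f = (a \<otimes> f) \<otimes> d" "(c \<otimes> f) \<otimes> b = (c \<otimes> b) \<otimes> f"
    "(e \<otimes> d) \<otimes> b = (e \<otimes> b) \<otimes> d"
    using m by (simp_all add: m_ac)
  ultimately have "(a \<otimes> f) \<otimes> d \<preceq> (e \<otimes> b) \<otimes> d"
    using m transp_onD[OF po_trans, of "(a \<otimes> f) \<otimes> d" "(c \<otimes> b) \<otimes> f" "(e \<otimes> b) \<otimes> d"] by simp
  then show ?thesis using m pqr by (simp add: mult_le_iff frac_le_def)
qed

lemma frac_mult_mono:
  assumes "p \<unlhd> q" "p \<in> fracs" "q \<in> fracs" "r \<in> fracs"
  shows "p \<odot> r \<unlhd> q \<odot> r"
proof -
  obtain a b c d e f where pqr: "p = (a, b)" "q = (c, d)" "r = (e, f)"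
    by (cases p; cases q; cases r)
  then have m: "a \<in> carrier M" "b \<in> carrier M" "c \<in> carrier M" "d \<in> carrier M"
    "e \<in> carrier M" "f \<in> carrier M"
    using assms by auto
  have "(a \<otimes> d) \<otimes> (e \<otimes> f) \<preceq> (c \<otimes> b) \<otimes> (e \<otimes> f)"
    using assms m pqr by (auto simp: mult_le_iff frac_le_def)
  moreover have "(a \<otimes> d) \<otimes> (e \<otimes> f) = (a \<otimes> e) \<otimes> (d \<otimes> f)"
    "(c \<otimes> b) \<otimes> (e \<otimes> f) = (c \<otimes> e) \<otimes> (b \<otimes> f)"
    using m by (simp_all add: m_ac)
  ultimately show ?thesis using pqr by (simp add: frac_le_def frac_mult_def)
qed

text \<open>Identifying fractions that are below each other, rather than only equal ones, makes the
  order on classes antisymmetric.\<close>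

definition frac_rel :: "(('a \<times> 'a) \<times> ('a \<times> 'a)) set"
  where "frac_rel = {(p, q). p \<in> fracs \<and> q \<in> fracs \<and> p \<unlhd> q \<and> q \<unlhd> p}"

lemma equiv_frac_rel: "equiv fracs frac_rel"
proof (rule equivI)
  show "trans frac_rel"
    unfolding frac_rel_def by (rule transI) (use frac_le_trans in blast)
qed (use frac_le_refl in \<open>auto simp: frac_rel_def refl_on_def sym_def\<close>)

definition frac_class :: "'a \<times> 'a \<Rightarrow> ('a \<times> 'a) set"
  where "frac_class p = frac_rel `` {p}"

lemma frac_class_eq_iff:
  "\<lbrakk>p \<in> fracs; q \<in> fracs\<rbrakk> \<Longrightarrow> frac_class p = frac_class q \<longleftrightarrow> p \<unlhd> q \<and> q \<unlhd> p"
  using eq_equiv_class_iff[OF equiv_frac_rel, of p q] by (auto simp: frac_class_def frac_rel_def)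

text \<open>The union avoids choosing representatives: by \<open>frac_class_mult\<close> all classes
  in it coincide.\<close>

definition frac_group :: "('a \<times> 'a) set monoid"
  where "frac_group =
    \<lparr>carrier = frac_class ` fracs,
     mult = (\<lambda>A B. \<Union>p\<in>A. \<Union>q\<in>B. frac_class (p \<odot> q)),
     one = frac_class (\<one>, \<one>)\<rparr>"

definition frac_group_le :: "('a \<times> 'a) set \<Rightarrow> ('a \<times> 'a) set \<Rightarrow> bool"
  where "frac_group_le A B \<longleftrightarrow> (\<exists>p\<in>A. \<exists>q\<in>B. p \<unlhd> q)"

lemma carrier_frac_group: "carrier frac_group = frac_class ` fracs"
  by (simp add: frac_group_def)

lemma one_frac_group: "\<one>\<^bsub>frac_group\<^esub> = frac_class (\<one>, \<one>)"
  by (simp add: frac_group_def)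

text \<open>The product respects classes because \<open>frac_mult_mono\<close> applies in both
  directions; by commutativity one argument suffices.\<close>

lemma frac_class_mult:
  assumes "p \<in> fracs" "q \<in> fracs"
  shows "frac_class p \<otimes>\<^bsub>frac_group\<^esub> frac_class q = frac_class (p \<odot> q)"
proof -
  have "congruent2 frac_rel frac_rel (\<lambda>p q. frac_class (p \<odot> q))"
  proof (rule congruent2_commuteI[OF equiv_frac_rel])
    show "frac_class (p \<odot> q) = frac_class (q \<odot> p)" if "p \<in> fracs" "q \<in> fracs" for p q
      using that frac_mult_comm by simp
    show "frac_class (r \<odot> p) = frac_class (r \<odot> q)"
      if "(p, q) \<in> frac_rel" "r \<in> fracs" for p q r
    proof -
      have "frac_class (p \<odot> r) = frac_class (q \<odot> r)"
        using that frac_mult_mono frac_mult_closed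
        by (subst frac_class_eq_iff) (auto simp: frac_rel_def)
      then show ?thesis using that frac_mult_comm by (simp add: frac_rel_def)
    qed
  qed
  then show ?thesis
    using UN_equiv_class2[OF equiv_frac_rel equiv_frac_rel _ assms]
    by (simp add: frac_group_def frac_class_def)
qed

lemma frac_group_le_iff:
  assumes "p \<in> fracs" "q \<in> fracs"
  shows "frac_group_le (frac_class p) (frac_class q) \<longleftrightarrow> p \<unlhd> q"
proof
  assume "frac_group_le (frac_class p) (frac_class q)"
  then obtain p' q' where "(p, p') \<in> frac_rel" "(q, q') \<in> frac_rel" "p' \<unlhd> q'"
    by (auto simp: frac_group_le_def frac_class_def)
  then show "p \<unlhd> q"
    using frac_le_trans[of p p' q'] frac_le_trans[of p q' q] by (auto simp: frac_rel_def)
next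
  assume "p \<unlhd> q"
  moreover have "p \<in> frac_class p" "q \<in> frac_class q"
    using assms frac_le_refl by (auto simp: frac_class_def frac_rel_def)
  ultimately show "frac_group_le (frac_class p) (frac_class q)"
    by (auto simp: frac_group_le_def)
qed

lemma frac_class_inverse:
  assumes "a \<in> carrier M" "b \<in> carrier M"
  shows "frac_class (b, a) \<otimes>\<^bsub>frac_group\<^esub> frac_class (a, b) = \<one>\<^bsub>frac_group\<^esub>"
proof -
  have "frac_class (b \<otimes> a, a \<otimes> b) = frac_class (\<one>, \<one>)"
    using assms reflp_onD[OF po_refl, of "a \<otimes> b"]
    by (subst frac_class_eq_iff) (auto simp: frac_le_def m_comm)
  then show ?thesis using assms by (simp add: frac_class_mult one_frac_group frac_mult_def)
qed

lemma comm_group_frac_group: "comm_group frac_group"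
proof (rule comm_groupI)
  show "\<one>\<^bsub>frac_group\<^esub> \<in> carrier frac_group"
    by (simp add: carrier_frac_group one_frac_group)
next
  fix A B assume "A \<in> carrier frac_group" "B \<in> carrier frac_group"
  then show "A \<otimes>\<^bsub>frac_group\<^esub> B \<in> carrier frac_group"
    "A \<otimes>\<^bsub>frac_group\<^esub> B = B \<otimes>\<^bsub>frac_group\<^esub> A"
    unfolding carrier_frac_group
    using frac_mult_closed frac_mult_comm by (auto simp: frac_class_mult simp del: mem_Times_iff)
next
  fix A B C
  assume "A \<in> carrier frac_group" "B \<in> carrier frac_group" "C \<in> carrier frac_group"
  then obtain p q r where "A = frac_class p" "B = frac_class q" "C = frac_class r"
    and "p \<in> fracs" "q \<in> fracs" "r \<in> fracs"
    unfolding carrier_frac_group by blast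
  then show "A \<otimes>\<^bsub>frac_group\<^esub> B \<otimes>\<^bsub>frac_group\<^esub> C = A \<otimes>\<^bsub>frac_group\<^esub> (B \<otimes>\<^bsub>frac_group\<^esub> C)"
    using frac_mult_closed[of p q] frac_mult_closed[of q r]
    by (simp add: frac_class_mult frac_mult_assoc del: mem_Times_iff)
next
  fix A assume "A \<in> carrier frac_group"
  then obtain a b where A: "A = frac_class (a, b)" "a \<in> carrier M" "b \<in> carrier M"
    unfolding carrier_frac_group by auto
  then show "\<one>\<^bsub>frac_group\<^esub> \<otimes>\<^bsub>frac_group\<^esub> A = A"
    by (simp add: one_frac_group frac_class_mult frac_mult_def)
  show "\<exists>B\<in>carrier frac_group. B \<otimes>\<^bsub>frac_group\<^esub> A = \<one>\<^bsub>frac_group\<^esub>"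
    using A frac_class_inverse[of a b] unfolding carrier_frac_group by blast
qed

lemma ordered_abelian_group_frac_group: "ordered_abelian_group frac_group frac_group_le"
proof -
  interpret G: comm_group frac_group by (fact comm_group_frac_group)
  show ?thesis
  proof
    show "reflp_on (carrier frac_group) frac_group_le"
      unfolding carrier_frac_group using frac_le_refl
      by (intro reflp_onI) (auto simp: frac_group_le_iff simp del: mem_Times_iff)
    show "transp_on (carrier frac_group) frac_group_le"
    proof (rule transp_onI)
      fix A B C
      assume "A \<in> carrier frac_group" "B \<in> carrier frac_group" "C \<in> carrier frac_group"
        and le: "frac_group_le A B" "frac_group_le B C"
      then obtain p q r where "A = frac_class p" "B = frac_class q" "C = frac_class r"
        and "p \<in> fracs" "q \<in> fracs" "r \<in> fracs"
        unfolding carrier_frac_group by blast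
      with le show "frac_group_le A C"
        using frac_le_trans[of p q r] by (simp add: frac_group_le_iff del: mem_Times_iff)
    qed
    show "antisymp_on (carrier frac_group) frac_group_le"
    proof (rule antisymp_onI)
      fix A B
      assume "A \<in> carrier frac_group" "B \<in> carrier frac_group"
        and le: "frac_group_le A B" "frac_group_le B A"
      then obtain p q where "A = frac_class p" "B = frac_class q" and "p \<in> fracs" "q \<in> fracs"
        unfolding carrier_frac_group by blast
      with le show "A = B"
        by (simp add: frac_group_le_iff frac_class_eq_iff del: mem_Times_iff)
    qed
    show "totalp_on (carrier frac_group) frac_group_le"
    proof (rule totalp_onI)
      fix A B assume "A \<in> carrier frac_group" "B \<in> carrier frac_group"
      then obtain p q where "A = frac_class p" "B = frac_class q" and "p \<in> fracs" "q \<in> fracs"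
        unfolding carrier_frac_group by blast
      then show "frac_group_le A B \<or> frac_group_le B A"
        using frac_le_linear[of p q] by (simp add: frac_group_le_iff del: mem_Times_iff)
    qed
  next
    fix A B C
    assume "A \<in> carrier frac_group" "B \<in> carrier frac_group" "C \<in> carrier frac_group"
      and le: "frac_group_le A B"
    then obtain p q r where "A = frac_class p" "B = frac_class q" "C = frac_class r"
      and "p \<in> fracs" "q \<in> fracs" "r \<in> fracs"
      unfolding carrier_frac_group by blast
    with le show "frac_group_le (A \<otimes>\<^bsub>frac_group\<^esub> C) (B \<otimes>\<^bsub>frac_group\<^esub> C)"
      using frac_mult_mono[of p q r] frac_mult_closed[of p r] frac_mult_closed[of q r]
      by (simp add: frac_group_le_iff frac_class_mult del: mem_Times_iff)
  qed
qed

definition frac_of :: "'a \<Rightarrow> ('a \<times> 'a) set"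
  where "frac_of x = frac_class (x, \<one>)"

lemma frac_of_closed: "x \<in> carrier M \<Longrightarrow> frac_of x \<in> carrier frac_group"
  by (simp add: frac_of_def carrier_frac_group)

lemma frac_of_mult:
  "\<lbrakk>x \<in> carrier M; y \<in> carrier M\<rbrakk> \<Longrightarrow> frac_of (x \<otimes> y) = frac_of x \<otimes>\<^bsub>frac_group\<^esub> frac_of y"
  by (simp add: frac_of_def frac_class_mult frac_mult_def)

lemma frac_of_one: "frac_of \<one> = \<one>\<^bsub>frac_group\<^esub>"
  by (simp add: frac_of_def one_frac_group)

lemma frac_of_le_iff:
  "\<lbrakk>x \<in> carrier M; y \<in> carrier M\<rbrakk> \<Longrightarrow> frac_group_le (frac_of x) (frac_of y) \<longleftrightarrow> x \<preceq> y"
  by (simp add: frac_of_def frac_group_le_iff frac_le_def)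

text \<open>Every fraction \<open>a / b\<close> is \<open>frac_of a\<close> times the inverse of
  \<open>frac_of b\<close>. This is what \<open>val_generates\<close> asks of the value
  group.\<close>

lemma generate_frac_of: "generate frac_group (frac_of ` carrier M) = carrier frac_group"
proof
  interpret G: comm_group frac_group by (fact comm_group_frac_group)
  show "generate frac_group (frac_of ` carrier M) \<subseteq> carrier frac_group"
    using frac_of_closed by (intro G.generate_incl) auto
  show "carrier frac_group \<subseteq> generate frac_group (frac_of ` carrier M)"
  proof
    fix A assume "A \<in> carrier frac_group"
    then obtain a b where A: "A = frac_class (a, b)" "a \<in> carrier M" "b \<in> carrier M"
      unfolding carrier_frac_group by auto
    have "inv\<^bsub>frac_group\<^esub> (frac_of b) = frac_class (\<one>, b)"
      using A frac_class_inverse[of b \<one>] frac_of_closed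
      by (intro G.inv_equality) (auto simp: frac_of_def carrier_frac_group)
    then have "A = frac_of a \<otimes>\<^bsub>frac_group\<^esub> inv\<^bsub>frac_group\<^esub> (frac_of b)"
      using A by (simp add: frac_of_def frac_class_mult frac_mult_def)
    moreover have "\<dots> \<in> generate frac_group (frac_of ` carrier M)"
      using A by (intro generate.eng generate.incl generate.inv) auto
    ultimately show "A \<in> generate frac_group (frac_of ` carrier M)" by simp
  qed
qed

end

section \<open>The valuation attached to a quasi-order with
  \<open>\<zero> \<preceq> \<ominus> \<one>\<close>\<close>

context quasi_ordered_ring
begin

definition nonsupport :: "'a monoid"
  where "nonsupport = \<lparr>carrier = {x \<in> carrier R. \<not> x \<sim> \<zero>}, mult = (\<otimes>), one = \<one>\<rparr>"

lemma nonsupport_iff: "x \<in> carrier nonsupport \<longleftrightarrow> x \<in> carrier R \<and> \<not> x \<sim> \<zero>"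
  and nonsupport_mult: "x \<otimes>\<^bsub>nonsupport\<^esub> y = x \<otimes> y"
  and nonsupport_one: "\<one>\<^bsub>nonsupport\<^esub> = \<one>"
  by (simp_all add: nonsupport_def)

text \<open>The order is reversed because large elements get small values. Closure under products is
  \<open>support_prime\<close>. Elements outside the support are strictly positive, so QR3 and QR5
  give the two directions of \<open>mult_le_iff\<close>.\<close>

lemma nonsupport_preordered:
  assumes m: "\<zero> \<preceq> \<ominus> \<one>"
  shows "total_preordered_monoid nonsupport (\<lambda>x y. y \<preceq> x)"
proof -
  have "comm_monoid nonsupport"
  proof (rule comm_monoidI)
    show "\<one>\<^bsub>nonsupport\<^esub> \<in> carrier nonsupport"
      using one_pos by (simp add: nonsupport_iff nonsupport_one order_equiv_def)
    show "x \<otimes>\<^bsub>nonsupport\<^esub> y \<in> carrier nonsupport"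
      if "x \<in> carrier nonsupport" "y \<in> carrier nonsupport" for x y
      using that support_prime[of x y] by (auto simp: nonsupport_iff nonsupport_mult)
  qed (auto simp: nonsupport_iff nonsupport_mult nonsupport_one m_assoc intro: m_comm)
  then interpret N: comm_monoid nonsupport .
  show ?thesis
  proof
    show "reflp_on (carrier nonsupport) (\<lambda>x y. y \<preceq> x)"
      using le_refl by (intro reflp_onI) (auto simp: nonsupport_iff)
    show "transp_on (carrier nonsupport) (\<lambda>x y. y \<preceq> x)"
      by (intro transp_onI) (auto simp: nonsupport_iff intro: le_trans)
    show "totalp_on (carrier nonsupport) (\<lambda>x y. y \<preceq> x)"
      using le_linear by (intro totalp_onI) (auto simp: nonsupport_iff)
  next
    fix x y z
    assume "x \<in> carrier nonsupport" "y \<in> carrier nonsupport" "z \<in> carrier nonsupport"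
    then show "y \<otimes>\<^bsub>nonsupport\<^esub> z \<preceq> x \<otimes>\<^bsub>nonsupport\<^esub> z \<longleftrightarrow> y \<preceq> x"
      using all_nonneg[OF m, of z] QR3[of y x z] QR5[of y x z]
      by (auto simp: nonsupport_iff nonsupport_mult order_equiv_def order_strict_def)
  qed
qed

lemma induced_by_valuation_if_minus_one_nonneg:
  assumes m: "\<zero> \<preceq> \<ominus> \<one>"
  shows "\<exists>(\<Gamma> :: ('a \<times> 'a) set monoid) gle v. induced_by_valuation R (\<preceq>) \<Gamma> gle v"
proof -
  interpret N: total_preordered_monoid nonsupport "\<lambda>x y. y \<preceq> x"
    by (rule nonsupport_preordered[OF m])
  interpret G: ordered_abelian_group N.frac_group N.frac_group_le
    by (rule N.ordered_abelian_group_frac_group)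
  define v where "v x = (if x \<sim> \<zero> then Infinity else Fin (N.frac_of x))" for x
  have v_le: "x \<preceq> y \<longleftrightarrow> inf_le N.frac_group_le (v y) (v x)"
    if xy: "x \<in> carrier R" "y \<in> carrier R" for x y
  proof (cases "x \<sim> \<zero> \<or> y \<sim> \<zero>")
    case False
    then show ?thesis using xy by (simp add: v_def N.frac_of_le_iff nonsupport_iff)
  next
    case True
    \<comment> \<open>All elements are nonnegative, so those of the support are the least ones,
      matching the largest value \<open>Infinity\<close>.\<close>
    then show ?thesis
      using xy all_nonneg[OF m] le_trans[of x \<zero> y] le_trans[of x y \<zero>]
      by (auto simp: v_def order_equiv_def)
  qed
  have "ring_valuation R N.frac_group N.frac_group_le v"
  proof
    show "v \<zero> = Infinity" by (simp add: v_def order_equiv_def le_refl)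
    have "\<not> \<one> \<sim> \<zero>" using one_pos by (simp add: order_equiv_def)
    then show "v \<one> = Fin \<one>\<^bsub>N.frac_group\<^esub>"
      using N.frac_of_one by (simp add: v_def nonsupport_one)
  next
    fix x assume "x \<in> carrier R"
    then show "v x \<in> insert Infinity (Fin ` carrier N.frac_group)"
      using N.frac_of_closed by (simp add: v_def nonsupport_iff)
  next
    fix x y assume xy: "x \<in> carrier R" "y \<in> carrier R"
    show "v (x \<otimes> y) = inf_add N.frac_group (v x) (v y)"
    proof (cases "x \<sim> \<zero> \<or> y \<sim> \<zero>")
      case False
      then show ?thesis
        using xy N.frac_of_mult[of x y, unfolded nonsupport_mult] support_prime[of x y]
        by (auto simp: v_def nonsupport_iff)
    next
      case True
      \<comment> \<open>The support absorbs products: a factor equivalent to \<open>\<zero>\<close>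
        is multiplied by the other, nonnegative one through QR3.\<close>
      then have "x \<otimes> y \<sim> \<zero>"
        using xy all_nonneg[OF m] QR3[of x \<zero> y] QR3[of y \<zero> x]
        by (auto simp: order_equiv_def m_comm)
      then show ?thesis using True by (cases "v x") (auto simp: v_def)
    qed
    \<comment> \<open>The minimum is the value of the larger summand, and the sum lies below that
      summand by \<open>ultrametric\<close>.\<close>
    show "inf_le N.frac_group_le (inf_min N.frac_group_le (v x) (v y)) (v (x \<oplus> y))"
      using xy ultrametric[OF m, of x y] ultrametric[OF m, of y x] le_linear[of x y] a_comm[of x y]
      by (auto simp: inf_min_def v_le[symmetric])
  next
    have "{g. \<exists>x\<in>carrier R. v x = Fin g} = N.frac_of ` carrier nonsupport"
      by (auto simp: v_def nonsupport_iff split: if_splits)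
    then show "carrier N.frac_group = generate N.frac_group {g. \<exists>x\<in>carrier R. v x = Fin g}"
      using N.generate_frac_of by simp
  qed
  with v_le show ?thesis unfolding induced_by_valuation_def by blast
qed

end

text \<open>The type of the value group stays arbitrary, since the theorem needs this both for sets
  of pairs and for an unrelated type \<open>'g\<close>.\<close>

lemma induced_by_valuation_imp:
  assumes "induced_by_valuation R leq \<Gamma> gle v"
  shows "quasi_ordered_ring R leq" "\<not> ord_ring R leq"
    "quasi_order_support R leq = valuation_support R v"
proof -
  interpret ring_valuation R \<Gamma> gle v
    using assms by (simp add: induced_by_valuation_def)
  have leq: "leq x y \<longleftrightarrow> inf_le gle (v y) (v x)" if "x \<in> carrier R" "y \<in> carrier R" for x y
    using that assms by (simp add: induced_by_valuation_def)
  show "quasi_ordered_ring R leq" "\<not> ord_ring R leq"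
    "quasi_order_support R leq = valuation_support R v"
    using quasi_ordered_ring_if_induced[OF leq] not_ord_ring_if_induced[OF leq]
      support_if_induced[OF leq] by blast+
qed

text \<open>Totality compares \<open>-1\<close> with \<open>0\<close>, and each outcome has been
  settled above.\<close>

lemma quasi_ordered_ring_cases:
  fixes R :: "('a, 'm) ring_scheme"
  assumes "quasi_ordered_ring R leq"
  obtains "ord_ring R leq"
  | \<Gamma> :: "('a \<times> 'a) set monoid" and gle v where "induced_by_valuation R leq \<Gamma> gle v"
proof -
  interpret quasi_ordered_ring R leq by fact
  have "leq (\<ominus>\<^bsub>R\<^esub> \<one>\<^bsub>R\<^esub>) \<zero>\<^bsub>R\<^esub> \<or> leq \<zero>\<^bsub>R\<^esub> (\<ominus>\<^bsub>R\<^esub> \<one>\<^bsub>R\<^esub>)" by (intro le_linear) auto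
  then show thesis
    using ord_ring_if_minus_one_neg induced_by_valuation_if_minus_one_nonneg that by blast
qed

theorem theorem4p7:
  fixes R :: "('a, 'm) ring_scheme" and leq :: "'a \<Rightarrow> 'a \<Rightarrow> bool"
  assumes "cring R"
  shows "(quasi_ordered_ring R leq \<longleftrightarrow>
      ord_ring R leq \<or>
      (\<exists>(\<Gamma> :: ('a \<times> 'a) set monoid) gle v. induced_by_valuation R leq \<Gamma> gle v)) \<and>
    (ord_ring R leq \<longrightarrow> quasi_order_support R leq = order_support R leq) \<and>
    (\<forall>(\<Gamma> :: 'g monoid) gle v. induced_by_valuation R leq \<Gamma> gle v \<longrightarrow>
      quasi_ordered_ring R leq \<and> \<not> ord_ring R leq \<and>
      quasi_order_support R leq = valuation_support R v)"
proof (intro conjI impI allI)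
  show "quasi_ordered_ring R leq \<longleftrightarrow> ord_ring R leq \<or>
      (\<exists>(\<Gamma> :: ('a \<times> 'a) set monoid) gle v. induced_by_valuation R leq \<Gamma> gle v)"
    (is "?Q \<longleftrightarrow> ?O \<or> ?V")
  proof
    assume ?Q
    then show "?O \<or> ?V"
    proof (cases rule: quasi_ordered_ring_cases)
      case 1
      then show ?thesis by (rule disjI1)
    next
      case (2 \<Gamma> gle v)
      then show ?thesis by (intro disjI2 exI)
    qed
  next
    assume "?O \<or> ?V"
    then show ?Q
      by (elim disjE exE) (fact ord_ring_imp_quasi_ordered_ring induced_by_valuation_imp(1))+
  qed
  show "quasi_order_support R leq = order_support R leq" if "ord_ring R leq"
    by (simp add: quasi_order_support_def order_support_def order_equiv_def)
qed (simp_all add: induced_by_valuation_imp)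

end
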